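(* Let $y\in\mathcal{Y}$ be such that $\min_{\xi\in\mathbb{Z}}y_\xi'>0$ and $$\phi''(y_\xi'+y_{\xi+1}')\le 0\qquad\forall\,\xi\in\mathcal{C}.$$ Then $$c(y)\ \ge\ c_{\rm qc}(y)-4\,\varepsilon\,\bar C_3\,\|y''\|_{\ell^\infty(\mathcal{C})},$$ where $\bar C_3=C_3\big(2\min_{\xi\in\mathcal{C}'}y_\xi'\big)$.
   Context: Lattice and spaces. Let $N\in\mathbb{N}$, $\varepsilon=1/N$, $F>0$, $x_\xi=\varepsilon\xi$ for $\xi\in\mathbb{Z}$. Set $\mathcal{U}=\{u\in\mathbb{R}^{\mathbb{Z}}: u_{\xi+N}=u_\xi\ \forall\xi\in\mathbb{Z},\ \sum_{\xi=1}^N u_\xi=0\}$ and $\mathcal{Y}=Fx+\mathcal{U}$. For $v\in\mathbb{R}^{\mathbb{Z}}$: $v_\xi'=\varepsilon^{-1}(v_\xi-v_{\xi-1})$, $v_\xi''=\varepsilon^{-2}(v_{\xi+1}-2v_\xi+v_{\xi-1})$. For $y\in\mathcal{Y}$ these differences are $N$-periodic in $\xi$. Norms. For $u\in\mathcal{U}$, $\|u\|_{\mathcal{U}^{1,2}}=\|u'\|_{\ell^2_\varepsilon}=(\varepsilon\sum_{\xi=1}^N|u_\xi'|^2)^{1/2}$. For an index set $S$, $\|v\|_{\ell^\infty(S)}=\max_{\xi\in S}|v_\xi|$ (equal to $0$ if $S=\emptyset$). Potential. $\phi\in C^3((0,+\infty];\mathbb{R})$, meaning that $\phi$ is $C^3$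 on $(0,\infty)$ and $\phi$ and its first three derivatives are bounded on $(\delta,+\infty)$ for every $\delta>0$; there is $r_*>0$ such that $\phi$ is convex in $(0,r_* )$ and concave in $(r_*,+\infty)$. Set $C_j(s)=\sup_{r\ge s}|\phi^{(j)}(r)|$ for $s>0$. Regions. $\mathcal{A}\subset\{1,\dots,N\}$ is the atomistic region, $\mathcal{C}=\{1,\dots,N\}\setminus\mathcal{A}$ the continuum region, $\mathcal{A}_\#=\bigcup_{j\in\mathbb{Z}}(Nj+\mathcal{A})$. Let $\mathcal{I}_\ell=\{\xi\in\mathcal{C}:\xi+1\in\mathcal{A}_\#\}$, $\mathcal{I}_r=\{\xi\in\mathcal{C}:\xi-1\in\mathcal{A}_\#\}$; it is assumed that $\mathcal{I}_\ell\cap\mathcal{I}_r=\emptyset$. Further, $\mathcal{I}_\ell'=\mathcal{I}_\ell+1$ (indices modulo $N$) and $\mathcal{C}'=\mathcal{C}\cup\mathcal{I}_\ell'$. Energies. For $y\in\mathcal{Y}$ with $y_\xi'>0$ for all $\xi$, $$\Phi(y)=\varepsilon\sum_{\xi=1}^N\big(\phi(y_\xi')+\phi(y_\xi'+y_{\xi+1}')\big),$$ $$\Phi_{\rm qc}(y)=\varepsilon\sum_{\xi=1}^N\phi(y_\xi')+\varepsilon\sum_{\xi\in\mathcal{A}}\phi(y_\xi'+y_{\xi+1}')+\varepsilon\sum_{\xi\in\mathcal{C}}\tfrac12\{\phi(2y_\xi')+\phi(2y_{\xi+1}')\}.$$ $D^2\Phi(y)$, $D^2\Phi_{\rm qc}(y)$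 denote the second variations, symmetric bilinear forms on $\mathcal{U}\times\mathcal{U}$. The stability constants are $$c(y)=\inf_{u\in\mathcal{U},\ \|u\|_{\mathcal{U}^{1,2}}=1}D^2\Phi(y)[u,u],\qquad c_{\rm qc}(y)=\inf_{u\in\mathcal{U},\ \|u\|_{\mathcal{U}^{1,2}}=1}D^2\Phi_{\rm qc}(y)[u,u].$$ *)

theory Defs
  imports "HOL-Analysis.Analysis"
begin

text \<open>Lattice functions are maps from \<open>int\<close> to \<open>real\<close>; \<open>N\<close> is the number of atoms in one period.\<close>

definition eps :: "nat \<Rightarrow> real" where
  "eps N = 1 / real N"

definition disp_space :: "nat \<Rightarrow> (int \<Rightarrow> real) set" where
  "disp_space N = {u. (\<forall>\<xi>. u (\<xi> + int N) = u \<xi>) \<and> (\<Sum>\<xi>=1..int N. u \<xi>) = 0}"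

definition deform_space :: "nat \<Rightarrow> real \<Rightarrow> (int \<Rightarrow> real) set" where
  "deform_space N F = {(\<lambda>\<xi>. F * (eps N * of_int \<xi>) + u \<xi>) | u. u \<in> disp_space N}"

definition diff1 :: "nat \<Rightarrow> (int \<Rightarrow> real) \<Rightarrow> int \<Rightarrow> real" where
  "diff1 N v \<xi> = (v \<xi> - v (\<xi> - 1)) / eps N"

definition diff2 :: "nat \<Rightarrow> (int \<Rightarrow> real) \<Rightarrow> int \<Rightarrow> real" where
  "diff2 N v \<xi> = (v (\<xi> + 1) - 2 * v \<xi> + v (\<xi> - 1)) / (eps N)\<^sup>2"

definition norm_U12 :: "nat \<Rightarrow> (int \<Rightarrow> real) \<Rightarrow> real" where
  "norm_U12 N u = sqrt (eps N * (\<Sum>\<xi>=1..int N. \<bar>diff1 N u \<xi>\<bar>\<^sup>2))"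

definition linf_norm :: "int set \<Rightarrow> (int \<Rightarrow> real) \<Rightarrow> real" where
  "linf_norm S v = (if S = {} then 0 else (MAX \<xi>\<in>S. \<bar>v \<xi>\<bar>))"

text \<open>The class \<open>C\<^sup>3((0,+\<infinity>])\<close>. Values of \<open>\<phi>\<close> on nonpositive arguments are irrelevant.\<close>

definition C3_potential :: "(real \<Rightarrow> real) \<Rightarrow> bool" where
  "C3_potential \<phi> \<longleftrightarrow>
     (\<forall>j<3. (deriv ^^ j) \<phi> differentiable_on {0<..}) \<and>
     continuous_on {0<..} ((deriv ^^ 3) \<phi>) \<and>
     (\<forall>\<delta>>0. \<forall>j\<le>3. bounded ((deriv ^^ j) \<phi> ` {\<delta><..}))"

definition deriv_bound :: "(real \<Rightarrow> real) \<Rightarrow> nat \<Rightarrow> real \<Rightarrow> real" where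
  "deriv_bound \<phi> j s = (SUP r\<in>{s..}. \<bar>(deriv ^^ j) \<phi> r\<bar>)"

definition cont_region :: "nat \<Rightarrow> int set \<Rightarrow> int set" where
  "cont_region N A = {1..int N} - A"

definition periodic_ext :: "nat \<Rightarrow> int set \<Rightarrow> int set" where
  "periodic_ext N A = (\<Union>j. (\<lambda>\<xi>. int N * j + \<xi>) ` A)"

definition interface_left :: "nat \<Rightarrow> int set \<Rightarrow> int set" where
  "interface_left N A = {\<xi> \<in> cont_region N A. \<xi> + 1 \<in> periodic_ext N A}"

definition interface_right :: "nat \<Rightarrow> int set \<Rightarrow> int set" where
  "interface_right N A = {\<xi> \<in> cont_region N A. \<xi> - 1 \<in> periodic_ext N A}"

text \<open>\<open>\<xi> mod N + 1\<close> is the representative of \<open>\<xi> + 1\<close> modulo \<open>N\<close> in \<open>{1..N}\<close>.\<close>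

definition cont_region_ext :: "nat \<Rightarrow> int set \<Rightarrow> int set" where
  "cont_region_ext N A =
     cont_region N A \<union> (\<lambda>\<xi>. \<xi> mod int N + 1) ` interface_left N A"

definition energy :: "nat \<Rightarrow> (real \<Rightarrow> real) \<Rightarrow> (int \<Rightarrow> real) \<Rightarrow> real" where
  "energy N \<phi> y =
     eps N * (\<Sum>\<xi>=1..int N. \<phi> (diff1 N y \<xi>) + \<phi> (diff1 N y \<xi> + diff1 N y (\<xi> + 1)))"

definition energy_qc :: "nat \<Rightarrow> int set \<Rightarrow> (real \<Rightarrow> real) \<Rightarrow> (int \<Rightarrow> real) \<Rightarrow> real" where
  "energy_qc N A \<phi> y =
     eps N * (\<Sum>\<xi>=1..int N. \<phi> (diff1 N y \<xi>))
   + eps N * (\<Sum>\<xi>\<in>A. \<phi> (diff1 N y \<xi> + diff1 N y (\<xi> + 1)))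
   + eps N * (\<Sum>\<xi>\<in>cont_region N A.
       1 / 2 * (\<phi> (2 * diff1 N y \<xi>) + \<phi> (2 * diff1 N y (\<xi> + 1))))"

definition second_variation ::
    "((int \<Rightarrow> real) \<Rightarrow> real) \<Rightarrow> (int \<Rightarrow> real) \<Rightarrow> (int \<Rightarrow> real) \<Rightarrow> (int \<Rightarrow> real) \<Rightarrow> real" where
  "second_variation E y u v =
     deriv (\<lambda>s. deriv (\<lambda>t. E (\<lambda>\<xi>. y \<xi> + s * u \<xi> + t * v \<xi>)) 0) 0"

text \<open>The infimum is taken in the extended reals: for \<open>N = 1\<close> the space of displacements is
  trivial and the infimum over the empty unit sphere is \<open>\<infinity>\<close>.\<close>

definition stability_const :: "nat \<Rightarrow> ((int \<Rightarrow> real) \<Rightarrow> real) \<Rightarrow> (int \<Rightarrow> real) \<Rightarrow> ereal" where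
  "stability_const N E y =
     (INF u\<in>{u \<in> disp_space N. norm_U12 N u = 1}. ereal (second_variation E y u u))"

end

(* Writing a, b for the strains of u on two adjacent bonds, the atomistic and the quasicontinuum
   second variations differ only through the next-nearest-neighbour terms in the continuum region.
   As phi'' is nonpositive there, (a + b)^2 = 2 a^2 + 2 b^2 - (a - b)^2 allows the atomistic term
   to be bounded below by its coefficient times the decoupled expression 2 a^2 + 2 b^2, which is the
   quasicontinuum term up to a Lipschitz error in phi''. *)
theory Submission
  imports Defs
begin

section \<open>Second derivatives at \<open>0\<close> of functions of one real variable\<close>

text \<open>\<open>deriv\<close> returns an arbitrary value where no derivative exists, so nested
  uses of it cannot be added or scaled freely. The relational form carries the existence of the
  first derivative near \<open>0\<close>, and is closed under finite sums and scalar
  multiples.\<close>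

definition has_second_deriv :: "(real \<Rightarrow> real) \<Rightarrow> real \<Rightarrow> bool" where
  "has_second_deriv f D \<longleftrightarrow>
     (\<exists>f'. (\<forall>\<^sub>F s in nhds 0. (f has_real_derivative f' s) (at s)) \<and>
           (f' has_real_derivative D) (at 0))"

lemma has_second_deriv_add:
  assumes "has_second_deriv f D" and "has_second_deriv g E"
  shows "has_second_deriv (\<lambda>s. f s + g s) (D + E)"
proof -
  obtain f' g' where f: "\<forall>\<^sub>F s in nhds 0. (f has_real_derivative f' s) (at s)"
      "(f' has_real_derivative D) (at 0)"
    and g: "\<forall>\<^sub>F s in nhds 0. (g has_real_derivative g' s) (at s)"
      "(g' has_real_derivative E) (at 0)"
    using assms unfolding has_second_deriv_def by blast
  have "\<forall>\<^sub>F s in nhds 0. ((\<lambda>s. f s + g s) has_real_derivative f' s + g' s) (at s)"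
    using f(1) g(1) by eventually_elim (rule DERIV_add)
  moreover have "((\<lambda>s. f' s + g' s) has_real_derivative D + E) (at 0)"
    using f(2) g(2) by (rule DERIV_add)
  ultimately show ?thesis
    unfolding has_second_deriv_def by (intro exI conjI)
qed

lemma has_second_deriv_cmult:
  assumes "has_second_deriv f D"
  shows "has_second_deriv (\<lambda>s. c * f s) (c * D)"
proof -
  obtain f' where f: "\<forall>\<^sub>F s in nhds 0. (f has_real_derivative f' s) (at s)"
      "(f' has_real_derivative D) (at 0)"
    using assms unfolding has_second_deriv_def by blast
  have "\<forall>\<^sub>F s in nhds 0. ((\<lambda>s. c * f s) has_real_derivative c * f' s) (at s)"
    using f(1) by eventually_elim (rule DERIV_cmult)
  moreover have "((\<lambda>s. c * f' s) has_real_derivative c * D) (at 0)"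
    using f(2) by (rule DERIV_cmult)
  ultimately show ?thesis
    unfolding has_second_deriv_def by (intro exI conjI)
qed

lemma has_second_deriv_zero: "has_second_deriv (\<lambda>s. 0) 0"
  unfolding has_second_deriv_def by (intro exI[of _ "\<lambda>s. 0"]) auto

lemma has_second_deriv_sum:
  assumes "\<And>i. i \<in> I \<Longrightarrow> has_second_deriv (f i) (D i)"
  shows "has_second_deriv (\<lambda>s. \<Sum>i\<in>I. f i s) (\<Sum>i\<in>I. D i)"
  using assms
  by (induction I rule: infinite_finite_induct)
     (simp_all add: has_second_deriv_zero has_second_deriv_add)

lemma C3_potential_deriv:
  assumes "C3_potential \<phi>" and "j < 3" and "r > 0"
  shows "((deriv ^^ j) \<phi> has_real_derivative (deriv ^^ Suc j) \<phi> r) (at r)"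
proof -
  have "(deriv ^^ j) \<phi> differentiable_on {0<..}"
    using assms by (simp add: C3_potential_def)
  then have "(deriv ^^ j) \<phi> differentiable (at r)"
    using assms(3) by (simp add: differentiable_on_eq_differentiable_at)
  then show ?thesis
    by (simp add: DERIV_deriv_iff_real_differentiable)
qed

text \<open>The chain rule, applied twice. As \<open>a > 0\<close>, the argument
  \<open>a + s * b\<close> stays in the half-line where \<phi> is regular for all \<open>s\<close>
  near \<open>0\<close>, which is all that \<open>has_second_deriv\<close> asks for.\<close>

lemma C3_potential_has_second_deriv:
  assumes \<phi>: "C3_potential \<phi>" and "a > 0"
  shows "has_second_deriv (\<lambda>s. \<phi> (a + s * b)) ((deriv ^^ 2) \<phi> a * b\<^sup>2)"
  unfolding has_second_deriv_def
proof (intro exI conjI)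
  have "((\<lambda>s. a + s * b) \<longlongrightarrow> a + 0 * b) (nhds 0)"
    by (intro tendsto_intros filterlim_ident)
  then have "\<forall>\<^sub>F s in nhds 0. a + s * b > 0"
    using \<open>a > 0\<close> by (intro order_tendstoD(1)) auto
  then show "\<forall>\<^sub>F s in nhds 0.
      ((\<lambda>s. \<phi> (a + s * b)) has_real_derivative deriv \<phi> (a + s * b) * b) (at s)"
  proof eventually_elim
    case (elim s)
    have "(\<phi> has_real_derivative deriv \<phi> (a + s * b)) (at (a + s * b))"
      using C3_potential_deriv[OF \<phi>, of 0 "a + s * b"] elim by simp
    moreover have "((\<lambda>s. a + s * b) has_real_derivative b) (at s)"
      by (auto intro!: derivative_eq_intros)
    ultimately show ?case
      by (rule DERIV_chain2)
  qed
  have "(deriv \<phi> has_real_derivative (deriv ^^ 2) \<phi> a) (at (a + 0 * b))"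
    using C3_potential_deriv[OF \<phi>, of 1 a] \<open>a > 0\<close> by (simp add: numeral_2_eq_2)
  moreover have "((\<lambda>s. a + s * b) has_real_derivative b) (at 0)"
    by (auto intro!: derivative_eq_intros)
  ultimately have "((\<lambda>s. deriv \<phi> (a + s * b)) has_real_derivative (deriv ^^ 2) \<phi> a * b) (at 0)"
    by (rule DERIV_chain2)
  from DERIV_cmult_right[OF this, of b]
  show "((\<lambda>s. deriv \<phi> (a + s * b) * b) has_real_derivative (deriv ^^ 2) \<phi> a * b\<^sup>2) (at 0)"
    by (simp add: power2_eq_square mult.assoc)
qed

text \<open>On the diagonal both directions are \<open>u\<close>, so the energy depends on
  \<open>s + t\<close> alone and the mixed derivative becomes an ordinary second derivative along
  one line.\<close>

lemma second_variation_eqI: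
  assumes "has_second_deriv (\<lambda>r. E (\<lambda>\<xi>. y \<xi> + r * u \<xi>)) D"
  shows "second_variation E y u u = D"
proof -
  define f where "f r = E (\<lambda>\<xi>. y \<xi> + r * u \<xi>)" for r
  obtain f' where f: "\<forall>\<^sub>F s in nhds 0. (f has_real_derivative f' s) (at s)"
    and f': "(f' has_real_derivative D) (at 0)"
    using assms unfolding has_second_deriv_def f_def by blast
  have shift: "E (\<lambda>\<xi>. y \<xi> + s * u \<xi> + t * u \<xi>) = f (s + t)" for s t
    by (simp add: f_def algebra_simps)
  have "\<forall>\<^sub>F s in nhds 0. deriv (\<lambda>t. f (s + t)) 0 = f' s"
    using f
  proof eventually_elim
    case (elim s)
    then have "(f has_real_derivative f' s) (at (s + 0))"
      by simp
    then have "((\<lambda>t. f (t + s)) has_real_derivative f' s) (at 0)"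
      using DERIV_shift[of f "f' s" 0 s] by (simp add: add.commute)
    then show ?case
      by (simp add: add.commute DERIV_imp_deriv)
  qed
  \<comment> \<open>The outer derivative sees only the germ at \<open>0\<close>, where the inner
    \<open>deriv\<close> agrees with \<open>f'\<close>.\<close>
  then have "((\<lambda>s. deriv (\<lambda>t. f (s + t)) 0) has_real_derivative D) (at 0)"
    using f' by (subst DERIV_cong_ev[OF refl _ refl])
  then show ?thesis
    by (simp add: second_variation_def shift DERIV_imp_deriv)
qed

section \<open>Second variations of the two energies\<close>

lemma diff1_line:
  "diff1 N (\<lambda>\<xi>. y \<xi> + s * u \<xi>) \<xi> = diff1 N y \<xi> + s * diff1 N u \<xi>"
  by (simp add: diff1_def algebra_simps add_divide_distrib diff_divide_distrib)

lemma second_variation_energy: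
  assumes \<phi>: "C3_potential \<phi>" and pos: "\<And>\<xi>. diff1 N y \<xi> > 0"
  shows "second_variation (energy N \<phi>) y u u =
    eps N * (\<Sum>\<xi>=1..int N. (deriv ^^ 2) \<phi> (diff1 N y \<xi>) * (diff1 N u \<xi>)\<^sup>2
      + (deriv ^^ 2) \<phi> (diff1 N y \<xi> + diff1 N y (\<xi> + 1)) * (diff1 N u \<xi> + diff1 N u (\<xi> + 1))\<^sup>2)"
proof (rule second_variation_eqI)
  \<comment> \<open>Each argument of \<phi> is regrouped as \<open>a + s * b\<close>, the shape that
    \<open>C3_potential_has_second_deriv\<close> expects.\<close>
  have *: "(diff1 N y \<xi> + s * diff1 N u \<xi>) + (diff1 N y (\<xi> + 1) + s * diff1 N u (\<xi> + 1))
      = (diff1 N y \<xi> + diff1 N y (\<xi> + 1)) + s * (diff1 N u \<xi> + diff1 N u (\<xi> + 1))" for s \<xi>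
    by (simp add: algebra_simps)
  show "has_second_deriv (\<lambda>r. energy N \<phi> (\<lambda>\<xi>. y \<xi> + r * u \<xi>))
    (eps N * (\<Sum>\<xi>=1..int N. (deriv ^^ 2) \<phi> (diff1 N y \<xi>) * (diff1 N u \<xi>)\<^sup>2
      + (deriv ^^ 2) \<phi> (diff1 N y \<xi> + diff1 N y (\<xi> + 1)) * (diff1 N u \<xi> + diff1 N u (\<xi> + 1))\<^sup>2))"
    unfolding energy_def diff1_line *
    by (intro has_second_deriv_cmult has_second_deriv_sum has_second_deriv_add
        C3_potential_has_second_deriv \<phi> pos add_pos_pos)
qed

lemma second_variation_energy_qc:
  assumes \<phi>: "C3_potential \<phi>" and pos: "\<And>\<xi>. diff1 N y \<xi> > 0"
  shows "second_variation (energy_qc N A \<phi>) y u u =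
    eps N * (\<Sum>\<xi>=1..int N. (deriv ^^ 2) \<phi> (diff1 N y \<xi>) * (diff1 N u \<xi>)\<^sup>2)
    + eps N * (\<Sum>\<xi>\<in>A. (deriv ^^ 2) \<phi> (diff1 N y \<xi> + diff1 N y (\<xi> + 1))
        * (diff1 N u \<xi> + diff1 N u (\<xi> + 1))\<^sup>2)
    + eps N * (\<Sum>\<xi>\<in>cont_region N A.
        1 / 2 * ((deriv ^^ 2) \<phi> (2 * diff1 N y \<xi>) * (2 * diff1 N u \<xi>)\<^sup>2
          + (deriv ^^ 2) \<phi> (2 * diff1 N y (\<xi> + 1)) * (2 * diff1 N u (\<xi> + 1))\<^sup>2))"
    (is "_ = ?D")
proof (rule second_variation_eqI)
  have *: "(diff1 N y \<xi> + s * diff1 N u \<xi>) + (diff1 N y (\<xi> + 1) + s * diff1 N u (\<xi> + 1))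
      = (diff1 N y \<xi> + diff1 N y (\<xi> + 1)) + s * (diff1 N u \<xi> + diff1 N u (\<xi> + 1))"
    and **: "2 * (diff1 N y \<xi> + s * diff1 N u \<xi>) = 2 * diff1 N y \<xi> + s * (2 * diff1 N u \<xi>)" for s \<xi>
    by (simp_all add: algebra_simps)
  show "has_second_deriv (\<lambda>r. energy_qc N A \<phi> (\<lambda>\<xi>. y \<xi> + r * u \<xi>)) ?D"
    unfolding energy_qc_def diff1_line * **
    by (intro has_second_deriv_cmult has_second_deriv_sum has_second_deriv_add
        C3_potential_has_second_deriv \<phi> pos add_pos_pos mult_pos_pos zero_less_numeral)
qed

section \<open>Bounds on the derivatives of the potential\<close>

lemma deriv_bound_upper:
  assumes "C3_potential \<phi>" and "j \<le> 3" and "s > 0" and "r \<ge> s"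
  shows "\<bar>(deriv ^^ j) \<phi> r\<bar> \<le> deriv_bound \<phi> j s"
proof -
  \<comment> \<open>Boundedness is assumed on open half-lines; starting at \<open>s / 2\<close>
    covers the closed half-line \<open>{s..}\<close> of the supremum.\<close>
  have "bounded ((deriv ^^ j) \<phi> ` {s / 2<..})"
    using assms by (simp add: C3_potential_def)
  then obtain B where B: "\<And>x. x > s / 2 \<Longrightarrow> \<bar>(deriv ^^ j) \<phi> x\<bar> \<le> B"
    unfolding bounded_iff by (metis greaterThan_iff imageI real_norm_def)
  show ?thesis
    unfolding deriv_bound_def
  proof (rule cSUP_upper)
    show "bdd_above ((\<lambda>r. \<bar>(deriv ^^ j) \<phi> r\<bar>) ` {s..})"
      using B \<open>s > 0\<close> by (intro bdd_aboveI2[of _ _ B]) auto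
  qed (use assms in auto)
qed

text \<open>The mean value inequality on the convex set \<open>{s..}\<close>, where
  \<open>deriv_bound\<close> dominates the third derivative.\<close>

lemma deriv2_Lipschitz:
  assumes "C3_potential \<phi>" and "s > 0" and "p \<ge> s" and "q \<ge> s"
  shows "\<bar>(deriv ^^ 2) \<phi> p - (deriv ^^ 2) \<phi> q\<bar> \<le> deriv_bound \<phi> 3 s * \<bar>p - q\<bar>"
proof -
  have "norm ((deriv ^^ 2) \<phi> p - (deriv ^^ 2) \<phi> q) \<le> deriv_bound \<phi> 3 s * norm (p - q)"
  proof (rule field_differentiable_bound[where S = "{s..}" and f' = "(deriv ^^ 3) \<phi>"])
    fix r assume "r \<in> {s..}"
    then show "((deriv ^^ 2) \<phi> has_field_derivative (deriv ^^ 3) \<phi> r) (at r within {s..})"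
      using C3_potential_deriv[OF assms(1), of 2 r] \<open>s > 0\<close>
      by (auto simp: eval_nat_numeral intro: has_field_derivative_at_within)
    show "norm ((deriv ^^ 3) \<phi> r) \<le> deriv_bound \<phi> 3 s"
      using deriv_bound_upper[OF assms(1), of 3 s r] assms(2) \<open>r \<in> {s..}\<close> by simp
  qed (use assms in auto)
  then show ?thesis
    by simp
qed

section \<open>Periodicity of strains and of their sums\<close>

lemma periodic_mod:
  fixes f :: "int \<Rightarrow> 'a"
  assumes per: "\<And>\<xi>. f (\<xi> + n) = f \<xi>"
  shows "f (\<xi> mod n) = f \<xi>"
proof -
  have *: "f (\<zeta> + int k * n) = f \<zeta>" for \<zeta> k
  proof (induction k)
    case (Suc k)
    have "f (\<zeta> + int (Suc k) * n) = f ((\<zeta> + int k * n) + n)"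
      by (simp add: algebra_simps)
    then show ?case
      using Suc per by simp
  qed simp
  have "f (\<xi> mod n + k * n) = f (\<xi> mod n)" for k
  proof (cases "k \<ge> 0")
    case True
    then show ?thesis
      using *[of "\<xi> mod n" "nat k"] by simp
  next
    case False
    then show ?thesis
      using *[of "\<xi> mod n + k * n" "nat (- k)"] by (simp add: algebra_simps)
  qed
  from this[of "\<xi> div n"] show ?thesis
    by simp
qed

lemma sum_periodic_shift:
  fixes f :: "int \<Rightarrow> real"
  assumes per: "\<And>\<xi>. f (\<xi> + int N) = f \<xi>" and "N \<ge> 1"
  shows "(\<Sum>\<xi>=1..int N. f (\<xi> + 1)) = (\<Sum>\<xi>=1..int N. f \<xi>)"
proof -
  have "(\<Sum>\<xi>=1..int N. f (\<xi> + 1)) = (\<Sum>\<xi>=2..int N + 1. f \<xi>)"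
    by (rule sum.reindex_bij_witness[where i = "\<lambda>\<xi>. \<xi> - 1" and j = "\<lambda>\<xi>. \<xi> + 1"]) auto
  \<comment> \<open>The shifted window loses the index \<open>1\<close> and gains
    \<open>N + 1\<close>, where \<open>f\<close> takes the same value.\<close>
  also have "{2..int N + 1} = insert (int N + 1) {2..int N}"
    using \<open>N \<ge> 1\<close> by auto
  also have "sum f \<dots> = f 1 + (\<Sum>\<xi>=2..int N. f \<xi>)"
    using per[of 1] by (simp add: add.commute)
  also have "\<dots> = sum f (insert 1 {2..int N})"
    by simp
  also have "insert 1 {2..int N} = {1..int N}"
    using \<open>N \<ge> 1\<close> by auto
  finally show ?thesis .
qed

lemma diff1_disp_space_periodic:
  assumes "u \<in> disp_space N"
  shows "diff1 N u (\<xi> + int N) = diff1 N u \<xi>"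
proof -
  have per: "u (\<zeta> + int N) = u \<zeta>" for \<zeta>
    using assms by (simp add: disp_space_def)
  have "u (\<xi> + int N - 1) = u (\<xi> - 1)"
    using per[of "\<xi> - 1"] by (simp add: algebra_simps)
  then show ?thesis
    by (simp add: diff1_def per)
qed

lemma diff1_deform_space_periodic:
  assumes "y \<in> deform_space N F"
  shows "diff1 N y (\<xi> + int N) = diff1 N y \<xi>"
proof -
  obtain u where u: "u \<in> disp_space N" and y: "y = (\<lambda>\<xi>. F * (eps N * of_int \<xi>) + u \<xi>)"
    using assms by (auto simp: deform_space_def)
  \<comment> \<open>The affine part contributes a constant. The quotient is left uncancelled because
    \<open>eps N\<close> is \<open>0\<close> for \<open>N = 0\<close>.\<close>
  have "diff1 N y \<zeta> = F * eps N / eps N + diff1 N u \<zeta>" for \<zeta>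
    unfolding y diff1_def add_divide_distrib[symmetric] by (simp add: algebra_simps)
  then show ?thesis
    using diff1_disp_space_periodic[OF u] by simp
qed

text \<open>Needed to read the minimum of the strains over all integers as a lower bound:
  \<open>Min\<close> has its usual meaning on finite sets.\<close>

lemma finite_range_periodic:
  fixes f :: "int \<Rightarrow> 'a"
  assumes "\<And>\<xi>. f (\<xi> + int N) = f \<xi>" and "N \<ge> 1"
  shows "finite (range f)"
proof (rule finite_subset)
  show "range f \<subseteq> f ` {0..<int N}"
  proof
    fix z assume "z \<in> range f"
    then obtain \<xi> where "z = f (\<xi> mod int N)"
      using periodic_mod[of f "int N"] assms(1) by auto
    moreover have "\<xi> mod int N \<in> {0..<int N}"
      using \<open>N \<ge> 1\<close> by auto
    ultimately show "z \<in> f ` {0..<int N}"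
      by blast
  qed
qed simp

section \<open>Neighbouring strains in the continuum region\<close>

text \<open>This is the source of the factor \<open>eps N\<close> in the error term.\<close>

lemma diff2_eq_diff1_jump:
  assumes "N \<ge> 1"
  shows "diff1 N y (\<xi> + 1) - diff1 N y \<xi> = eps N * diff2 N y \<xi>"
  using assms by (simp add: diff1_def diff2_def eps_def field_simps power2_eq_square)

text \<open>A continuum bond involves the strains at \<open>\<xi>\<close> and
  \<open>\<xi> + 1\<close>. If the second index is atomistic, \<open>\<xi>\<close> is a left
  interface point and its successor was adjoined by definition; otherwise the representative of the
  successor is itself a continuum index.\<close>

lemma succ_mod_in_cont_region_ext:
  assumes A: "A \<subseteq> {1..int N}" and "N \<ge> 1" and \<xi>: "\<xi> \<in> cont_region N A"
  shows "\<xi> mod int N + 1 \<in> cont_region_ext N A"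
proof (cases "\<xi> + 1 \<in> periodic_ext N A")
  case True
  then show ?thesis
    using \<xi> by (auto simp: cont_region_ext_def interface_left_def)
next
  case False
  have "\<xi> mod int N + 1 \<notin> A"
  proof
    assume "\<xi> mod int N + 1 \<in> A"
    \<comment> \<open>This exhibits \<open>\<xi> + 1\<close> as a translate of its representative by
      a multiple of \<open>N\<close>.\<close>
    moreover have "\<xi> + 1 = int N * (\<xi> div int N) + (\<xi> mod int N + 1)"
      by simp
    ultimately show False
      using False unfolding periodic_ext_def by blast
  qed
  moreover have "0 \<le> \<xi> mod int N" "\<xi> mod int N < int N"
    using \<open>N \<ge> 1\<close> by auto
  ultimately show ?thesis
    by (auto simp: cont_region_ext_def cont_region_def)
qed

lemma finite_cont_region: "finite (cont_region N A)"
  by (simp add: cont_region_def)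

lemma finite_cont_region_ext: "finite (cont_region_ext N A)"
  by (simp add: cont_region_ext_def interface_left_def finite_cont_region)

section \<open>Comparison of the two second variations\<close>

lemma linf_norm_upper:
  assumes "finite S" and "\<xi> \<in> S"
  shows "\<bar>v \<xi>\<bar> \<le> linf_norm S v"
  using assms by (auto simp: linf_norm_def)

text \<open>Here \<open>k\<close> stands for \<open>\<phi>''\<close> at the sum of two adjacent strains and \<open>k1\<close>, \<open>k2\<close> for its
  values at twice the individual strains.\<close>

lemma bond_term_lower_bound:
  fixes k k1 k2 L a b :: real
  assumes "k \<le> 0" and "\<bar>k - k1\<bar> \<le> L" and "\<bar>k - k2\<bar> \<le> L"
  shows "1 / 2 * (k1 * (2 * a)\<^sup>2 + k2 * (2 * b)\<^sup>2) - 2 * L * (a\<^sup>2 + b\<^sup>2) \<le> k * (a + b)\<^sup>2"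
proof -
  have "k * (a - b)\<^sup>2 \<le> 0"
    using assms(1) by (simp add: mult_nonpos_nonneg)
  \<comment> \<open>Since \<open>1 / 2 * (2 * a)\<^sup>2\<close> is \<open>2 * a\<^sup>2\<close>,
    replacing \<open>k1\<close> by \<open>k\<close> costs at most \<open>2 * L * a\<^sup>2\<close>,
    and likewise for \<open>k2\<close>.\<close>
  moreover have "(k1 - k) * a\<^sup>2 \<le> L * a\<^sup>2" "(k2 - k) * b\<^sup>2 \<le> L * b\<^sup>2"
    using assms(2,3) by (auto intro!: mult_right_mono)
  ultimately show ?thesis
    by (simp add: power2_eq_square algebra_simps)
qed

text \<open>The estimate for one displacement, before normalisation. Each continuum bond costs
  \<open>2 * L\<close> times its two squared strains, and each strain belongs to at most two bonds,
  whence the constant \<open>4\<close>.\<close>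

lemma second_variation_qc_le:
  assumes "N \<ge> 1" and \<phi>: "C3_potential \<phi>" and A: "A \<subseteq> {1..int N}"
    and y: "y \<in> deform_space N F" and pos: "\<And>\<xi>. diff1 N y \<xi> > 0"
    and conc: "\<And>\<xi>. \<xi> \<in> cont_region N A \<Longrightarrow>
      (deriv ^^ 2) \<phi> (diff1 N y \<xi> + diff1 N y (\<xi> + 1)) \<le> 0"
    and u: "u \<in> disp_space N"
  shows "second_variation (energy_qc N A \<phi>) y u u
      - 4 * eps N * deriv_bound \<phi> 3 (2 * (MIN \<xi>\<in>cont_region_ext N A. diff1 N y \<xi>))
          * linf_norm (cont_region N A) (diff2 N y) * (norm_U12 N u)\<^sup>2
    \<le> second_variation (energy N \<phi>) y u u"
proof -
  define C where "C = cont_region N A"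
  define m where "m = (MIN \<xi>\<in>cont_region_ext N A. diff1 N y \<xi>)"
  define K where "K = deriv_bound \<phi> 3 (2 * m)"
  define M where "M = linf_norm C (diff2 N y)"
  \<comment> \<open>Bounds the change of the second derivative of \<phi> between the sum of two
    adjacent strains and twice either one.\<close>
  define L where "L = K * (eps N * M)"
  define g where "g = diff1 N y"
  define d where "d = diff1 N u"
  define p2 where "p2 = (deriv ^^ 2) \<phi>"
  define S where "S = (\<Sum>\<xi>=1..int N. (d \<xi>)\<^sup>2)"
  have eps: "eps N > 0"
    using \<open>N \<ge> 1\<close> by (simp add: eps_def)
  have per_d: "d (\<xi> + int N) = d \<xi>" for \<xi>
    using diff1_disp_space_periodic[OF u] by (simp add: d_def)
  have per_g: "g (\<xi> + int N) = g \<xi>" for \<xi>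
    using diff1_deform_space_periodic[OF y] by (simp add: g_def)
  \<comment> \<open>\<open>cont_region_ext\<close> holds representatives in \<open>{1..N}\<close>,
    whereas the bond at \<open>\<xi> = N\<close> refers to the index \<open>N + 1\<close>.\<close>
  have gmod: "g (\<xi> mod int N + 1) = g (\<xi> + 1)" for \<xi>
    using periodic_mod[of "\<lambda>\<zeta>. g (\<zeta> + 1)" "int N" \<xi>] per_g
    by (metis add.assoc add.commute)
  have m_le: "m \<le> g \<xi>" if "\<xi> \<in> cont_region_ext N A" for \<xi>
    using that finite_cont_region_ext[of N A] by (auto simp: m_def g_def)
  have bond: "1 / 2 * (p2 (2 * g \<xi>) * (2 * d \<xi>)\<^sup>2 + p2 (2 * g (\<xi> + 1)) * (2 * d (\<xi> + 1))\<^sup>2)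
      - 2 * L * ((d \<xi>)\<^sup>2 + (d (\<xi> + 1))\<^sup>2)
      \<le> p2 (g \<xi> + g (\<xi> + 1)) * (d \<xi> + d (\<xi> + 1))\<^sup>2"
    and L_nonneg: "L \<ge> 0" if \<xi>: "\<xi> \<in> C" for \<xi>
  proof -
    \<comment> \<open>A continuum index makes the minimum \<open>m\<close> one of the strains, hence
      positive; this gives the signs of \<open>K\<close> and \<open>L\<close>.\<close>
    have ne: "cont_region_ext N A \<noteq> {}"
      using \<xi> by (auto simp: C_def cont_region_ext_def)
    have "m \<in> g ` cont_region_ext N A"
      unfolding m_def g_def using finite_cont_region_ext[of N A] ne by (intro Min_in) auto
    then have m: "m > 0"
      using pos by (auto simp: g_def)
    have m1: "m \<le> g \<xi>"
      using \<xi> by (intro m_le) (auto simp: C_def cont_region_ext_def)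
    have m2: "m \<le> g (\<xi> + 1)"
      using m_le[OF succ_mod_in_cont_region_ext[OF A \<open>N \<ge> 1\<close>]] \<xi> by (simp add: C_def gmod)
    have "\<bar>diff2 N y \<xi>\<bar> \<le> M"
      unfolding M_def using \<xi> finite_cont_region by (intro linf_norm_upper) (auto simp: C_def)
    then have jump: "\<bar>g (\<xi> + 1) - g \<xi>\<bar> \<le> eps N * M"
      using diff2_eq_diff1_jump[OF \<open>N \<ge> 1\<close>, of y \<xi>] eps by (simp add: g_def abs_mult)
    have "0 \<le> \<bar>(deriv ^^ 3) \<phi> (2 * m)\<bar>"
      by simp
    also have "\<dots> \<le> K"
      unfolding K_def using m by (intro deriv_bound_upper \<phi>) auto
    finally have K: "K \<ge> 0" .
    show "L \<ge> 0"
      unfolding L_def using K jump by (intro mult_nonneg_nonneg[OF K]) linarith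
    \<comment> \<open>The sum \<open>g \<xi> + g (\<xi> + 1)\<close> differs from
      \<open>2 * g \<xi>\<close> and from \<open>2 * g (\<xi> + 1)\<close> by exactly one strain
      jump, up to sign, and all three are at least \<open>2 * m\<close>.\<close>
    have lip: "\<bar>p2 q - p2 r\<bar> \<le> L" if "q \<ge> 2 * m" "r \<ge> 2 * m" "\<bar>q - r\<bar> = \<bar>g (\<xi> + 1) - g \<xi>\<bar>" for q r
    proof -
      have "\<bar>p2 q - p2 r\<bar> \<le> K * \<bar>q - r\<bar>"
        unfolding p2_def K_def using m that by (intro deriv2_Lipschitz \<phi>) auto
      also have "\<dots> \<le> L"
        unfolding L_def using that(3) jump K by (intro mult_left_mono) auto
      finally show ?thesis .
    qed
    show "1 / 2 * (p2 (2 * g \<xi>) * (2 * d \<xi>)\<^sup>2 + p2 (2 * g (\<xi> + 1)) * (2 * d (\<xi> + 1))\<^sup>2)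
      - 2 * L * ((d \<xi>)\<^sup>2 + (d (\<xi> + 1))\<^sup>2)
      \<le> p2 (g \<xi> + g (\<xi> + 1)) * (d \<xi> + d (\<xi> + 1))\<^sup>2"
    proof (rule bond_term_lower_bound)
      show "p2 (g \<xi> + g (\<xi> + 1)) \<le> 0"
        using conc \<xi> by (simp add: p2_def g_def C_def)
    qed (use m1 m2 in \<open>auto intro!: lip\<close>)
  qed
  have "2 * L * (\<Sum>\<xi>\<in>C. (d \<xi>)\<^sup>2 + (d (\<xi> + 1))\<^sup>2) \<le> 2 * L * (2 * S)"
  \<comment> \<open>With no continuum index, \<open>m\<close> is the minimum of an empty set and the
    sign of \<open>K\<close> is unknown, but \<open>linf_norm\<close> is \<open>0\<close> by
    convention, so \<open>L\<close> vanishes.\<close>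
  proof (cases "C = {}")
    case True
    then show ?thesis
      by (simp add: L_def M_def linf_norm_def)
  next
    case False
    \<comment> \<open>Nonnegative terms allow the sum to be extended to a full period, where the
      shifted squares again add up to \<open>S\<close>.\<close>
    have "(\<Sum>\<xi>\<in>C. (d \<xi>)\<^sup>2 + (d (\<xi> + 1))\<^sup>2) \<le> (\<Sum>\<xi>=1..int N. (d \<xi>)\<^sup>2 + (d (\<xi> + 1))\<^sup>2)"
      by (rule sum_mono2) (auto simp: C_def cont_region_def)
    also have "\<dots> = 2 * S"
      using sum_periodic_shift[of "\<lambda>\<xi>. (d \<xi>)\<^sup>2" N] per_d \<open>N \<ge> 1\<close> by (simp add: sum.distrib S_def)
    finally show ?thesis
      using L_nonneg False by (intro mult_left_mono) auto
  qed
  moreover have "(\<Sum>\<xi>\<in>C. 1 / 2 * (p2 (2 * g \<xi>) * (2 * d \<xi>)\<^sup>2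
        + p2 (2 * g (\<xi> + 1)) * (2 * d (\<xi> + 1))\<^sup>2)) - 2 * L * (\<Sum>\<xi>\<in>C. (d \<xi>)\<^sup>2 + (d (\<xi> + 1))\<^sup>2)
      \<le> (\<Sum>\<xi>\<in>C. p2 (g \<xi> + g (\<xi> + 1)) * (d \<xi> + d (\<xi> + 1))\<^sup>2)"
    unfolding sum_distrib_left sum_subtractf[symmetric] by (rule sum_mono) (rule bond)
  ultimately have main: "(\<Sum>\<xi>\<in>C. 1 / 2 * (p2 (2 * g \<xi>) * (2 * d \<xi>)\<^sup>2
        + p2 (2 * g (\<xi> + 1)) * (2 * d (\<xi> + 1))\<^sup>2)) - 4 * L * S
      \<le> (\<Sum>\<xi>\<in>C. p2 (g \<xi> + g (\<xi> + 1)) * (d \<xi> + d (\<xi> + 1))\<^sup>2)" (is "?Q - _ \<le> ?C")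
    by linarith
  \<comment> \<open>\<open>T\<close> (nearest neighbours) and \<open>R\<close> (next-nearest
    neighbours in \<open>A\<close>) occur in both second variations, so the comparison reduces to
    \<open>main\<close>.\<close>
  define T where "T = (\<Sum>\<xi>=1..int N. p2 (g \<xi>) * (d \<xi>)\<^sup>2)"
  define R where "R = (\<Sum>\<xi>\<in>A. p2 (g \<xi> + g (\<xi> + 1)) * (d \<xi> + d (\<xi> + 1))\<^sup>2)"
  have "(\<Sum>\<xi>=1..int N. p2 (g \<xi> + g (\<xi> + 1)) * (d \<xi> + d (\<xi> + 1))\<^sup>2) = ?C + R"
    unfolding R_def C_def cont_region_def using A by (intro sum.subset_diff) auto
  then have full: "second_variation (energy N \<phi>) y u u = eps N * (T + (?C + R))"
    unfolding second_variation_energy[OF \<phi> pos] by (simp add: sum.distrib T_def p2_def g_def d_def)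
  have qc: "second_variation (energy_qc N A \<phi>) y u u = eps N * (T + R + ?Q)"
    unfolding second_variation_energy_qc[OF \<phi> pos]
    by (simp add: T_def R_def p2_def g_def d_def C_def distrib_left)
  have norm: "(norm_U12 N u)\<^sup>2 = eps N * S"
  proof -
    have "eps N * S \<ge> 0"
      using eps by (simp add: S_def sum_nonneg)
    then show ?thesis
      by (simp add: norm_U12_def S_def d_def)
  qed
  have "eps N * (T + R + ?Q) - eps N * (4 * L * S) = eps N * (T + R + (?Q - 4 * L * S))"
    by (simp add: algebra_simps)
  also have "\<dots> \<le> eps N * (T + R + ?C)"
    using main eps by (intro mult_left_mono) auto
  finally have "eps N * (T + R + ?Q) - eps N * (4 * L * S) \<le> eps N * (T + (?C + R))"
    by (simp add: algebra_simps)
  then show ?thesis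
    unfolding full qc norm by (simp add: L_def K_def M_def m_def C_def mult_ac)
qed

section \<open>Passage to the stability constants\<close>

theorem mainTheorem2:
  fixes N :: nat and F r_star :: real and \<phi> :: "real \<Rightarrow> real"
    and A :: "int set" and y :: "int \<Rightarrow> real"
  assumes "N \<ge> 1" and "F > 0"
    and "C3_potential \<phi>"
    and "r_star > 0"
    and "convex_on {0<..<r_star} \<phi>"
    and "concave_on {r_star<..} \<phi>"
    and "A \<subseteq> {1..int N}"
    and "interface_left N A \<inter> interface_right N A = {}"
    and "y \<in> deform_space N F"
    and "(MIN \<xi>. diff1 N y \<xi>) > 0"
    and "\<forall>\<xi>\<in>cont_region N A. (deriv ^^ 2) \<phi> (diff1 N y \<xi> + diff1 N y (\<xi> + 1)) \<le> 0"
  shows "stability_const N (energy N \<phi>) y \<ge>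
           stability_const N (energy_qc N A \<phi>) y
           - ereal (4 * eps N
               * deriv_bound \<phi> 3 (2 * (MIN \<xi>\<in>cont_region_ext N A. diff1 N y \<xi>))
               * linf_norm (cont_region N A) (diff2 N y))"
proof -
  have per: "diff1 N y (\<xi> + int N) = diff1 N y \<xi>" for \<xi>
    using diff1_deform_space_periodic[OF assms(9)] .
  have fin: "finite (range (diff1 N y))"
    using finite_range_periodic[of "diff1 N y" N] per assms(1) by blast
  have pos: "diff1 N y \<xi> > 0" for \<xi>
    using assms(10) fin by auto
  define B where "B = 4 * eps N
    * deriv_bound \<phi> 3 (2 * (MIN \<xi>\<in>cont_region_ext N A. diff1 N y \<xi>))
    * linf_norm (cont_region N A) (diff2 N y)"
  have "stability_const N (energy_qc N A \<phi>) y - ereal B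
      \<le> ereal (second_variation (energy N \<phi>) y u u)"
    if u: "u \<in> disp_space N" "norm_U12 N u = 1" for u
  proof -
    have "stability_const N (energy_qc N A \<phi>) y \<le> ereal (second_variation (energy_qc N A \<phi>) y u u)"
      unfolding stability_const_def using u by (intro INF_lower) auto
    then have "stability_const N (energy_qc N A \<phi>) y - ereal B
        \<le> ereal (second_variation (energy_qc N A \<phi>) y u u) - ereal B"
      by (intro ereal_minus_mono) auto
    also have "\<dots> \<le> ereal (second_variation (energy N \<phi>) y u u)"
      using second_variation_qc_le[OF assms(1,3,7,9) pos _ u(1)] assms(11) u(2)
      by (simp add: B_def)
    finally show ?thesis .
  qed
  \<comment> \<open>The left side does not depend on \<open>u\<close>, so it bounds the atomistic
    infimum. This includes \<open>N = 1\<close>, where the unit sphere is empty and the infimum is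
    infinite.\<close>
  then show ?thesis
    unfolding B_def[symmetric] by (subst (2) stability_const_def) (auto intro!: INF_greatest)
qed

end
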